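(* Let $\overline{\alpha}\in(1,2)$ be the number defined implicitly by $$\frac{\overline{\alpha}^{\overline{\alpha}}}{(\overline{\alpha}-1)^{\overline{\alpha}-1}}=\overline{\alpha}+1,$$ and let $1<\alpha<\overline{\alpha}$. Then the Mittag--Leffler function $E_{\alpha,2}(x)=\sum_{k=0}^\infty\frac{x^k}{\Gamma(k\alpha+2)}$ has no real zeros for $$x\in\left(-\Gamma(\alpha)(1+\alpha),0\right),$$ and moreover $$\left(-\Gamma(\alpha)(1+\alpha),0\right)\supset\left[-\Gamma(\alpha)\frac{\alpha^\alpha}{(\alpha-1)^{\alpha-1}},0\right).$$
   Context: $\Gamma$ is the Gamma function. The equation $\frac{y^{y}}{(y-1)^{y-1}}=y+1$ has exactly one solution $y\in(1,2)$, so $\overline{\alpha}$ is well defined. *)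

theory Defs
  imports "HOL-Analysis.Analysis"
begin

text \<open>
  The two-parameter Mittag-Leffler function on the reals. For \<open>a > 0\<close> the series converges for
  every \<open>x\<close>. At the poles of \<open>Gamma\<close> the term is \<open>x ^ k / 0 = 0\<close>, which agrees with the
  usual convention that the reciprocal Gamma function vanishes there.
\<close>

definition mittag_leffler :: "real \<Rightarrow> real \<Rightarrow> real \<Rightarrow> real" where
  "mittag_leffler a b x = (\<Sum>k. x ^ k / Gamma (real k * a + b))"

end

theory Submission
  imports Defs
begin

text \<open>
  Put \<open>x = - z\<close> with \<open>0 < z\<close>. Then \<open>E(\<alpha>, 2; x)\<close> is the alternating series of the terms
  \<open>z ^ k / \<Gamma>(k \<alpha> + 2)\<close>, and two consecutive terms have the ratio
  \<open>z \<Gamma>(k \<alpha> + 2) / \<Gamma>(k \<alpha> + \<alpha> + 2)\<close>. Since \<open>\<Gamma>\<close> is logarithmically convex, this ratio is largest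
  at \<open>k = 0\<close>, where it is \<open>z / \<Gamma>(\<alpha> + 2)\<close>. So as soon as \<open>z < \<Gamma>(\<alpha> + 2)\<close> the terms decrease
  geometrically, and the Leibniz criterion bounds the sum below by its first two terms,
  \<open>1 - z / \<Gamma>(\<alpha> + 2) > 0\<close>. The range in question is covered because
  \<open>\<Gamma>(\<alpha> + 2) = (1 + \<alpha>) \<alpha> \<Gamma>(\<alpha>)\<close> and \<open>\<alpha> > 1\<close>.

  The inclusion of the intervals says \<open>\<alpha>\<^sup>\<alpha> / (\<alpha> - 1)\<^bsup>\<alpha> - 1\<^esup> < \<alpha> + 1\<close>. The logarithm of the quotient
  of the two sides is strictly increasing on \<open>(1, \<infinity>)\<close> and vanishes at the larger point \<open>\<alpha>bar\<close>.
\<close>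

text \<open>
  Logarithmic convexity of \<open>\<Gamma>\<close>, in the form that \<open>y \<mapsto> \<Gamma>(y + a) / \<Gamma>(y)\<close> is increasing: the points
  \<open>x + a\<close> and \<open>y\<close> lie between \<open>x\<close> and \<open>y + a\<close> and have the same sum.
\<close>

lemma Gamma_shift_ratio_mono:
  fixes x y a :: real
  assumes "0 < x" "x \<le> y" "0 < a"
  shows "Gamma (x + a) * Gamma y \<le> Gamma x * Gamma (y + a)"
proof -
  define t where "t = a / (y - x + a)"
  have t: "0 \<le> t" "t \<le> 1" and t_mult: "t * (y - x + a) = a"
    using assms by (auto simp: t_def field_simps)
  have 1: "(1 - t) *\<^sub>R x + t *\<^sub>R (y + a) = x + a"
    using t_mult by (simp add: algebra_simps)
  have 2: "(1 - (1 - t)) *\<^sub>R x + (1 - t) *\<^sub>R (y + a) = y"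
    using t_mult by (simp add: algebra_simps)
  note conv = convex_onD[OF log_convex_Gamma_real, of _ x "y + a"]
  have "ln (Gamma (x + a)) \<le> (1 - t) * ln (Gamma x) + t * ln (Gamma (y + a))"
    using conv[of t] t assms unfolding 1 by simp
  moreover have "ln (Gamma y) \<le> t * ln (Gamma x) + (1 - t) * ln (Gamma (y + a))"
    using conv[of "1 - t"] t assms unfolding 2 by simp
  ultimately have "ln (Gamma (x + a)) + ln (Gamma y) \<le> ln (Gamma x) + ln (Gamma (y + a))"
    by (simp add: algebra_simps)
  moreover have pos: "0 < Gamma (x + a)" "0 < Gamma y" "0 < Gamma x" "0 < Gamma (y + a)"
    using assms by (auto intro!: Gamma_real_pos)
  ultimately have "ln (Gamma (x + a) * Gamma y) \<le> ln (Gamma x * Gamma (y + a))"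
    by (simp add: ln_mult)
  then show ?thesis
    using pos by (subst (asm) ln_le_cancel_iff) simp_all
qed

lemma mittag_leffler_2_pos:
  fixes \<alpha> z :: real
  assumes "0 < \<alpha>" "0 \<le> z" "z < Gamma (\<alpha> + 2)"
  shows "0 < mittag_leffler \<alpha> 2 (- z)"
proof -
  define a where "a k = z ^ k / Gamma (real k * \<alpha> + 2)" for k
  define q where "q = z / Gamma (\<alpha> + 2)"
  have G_pos: "0 < Gamma (real k * \<alpha> + 2)" for k
    using assms by (intro Gamma_real_pos add_nonneg_pos) auto
  have q: "0 \<le> q" "q < 1"
    using assms by (auto simp: q_def)
  have Gamma_2: "Gamma (2::real) = 1"
    using Gamma_fact[of 1, where ?'a = real] by simp
  have a_nonneg: "0 \<le> a k" for k
    using G_pos[of k] assms by (simp add: a_def)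
  have a_Suc: "a (Suc k) \<le> q * a k" for k
  proof -
    have "Gamma (2 + \<alpha>) * Gamma (real k * \<alpha> + 2) \<le> Gamma 2 * Gamma (real k * \<alpha> + 2 + \<alpha>)"
      using assms by (intro Gamma_shift_ratio_mono) auto
    then have "Gamma (\<alpha> + 2) * Gamma (real k * \<alpha> + 2) \<le> Gamma (real (Suc k) * \<alpha> + 2)"
      by (simp add: Gamma_2 algebra_simps)
    moreover have "0 < Gamma (\<alpha> + 2) * Gamma (real k * \<alpha> + 2)"
      using assms G_pos[of k] by simp
    ultimately have "z * z ^ k / Gamma (real (Suc k) * \<alpha> + 2)
        \<le> z * z ^ k / (Gamma (\<alpha> + 2) * Gamma (real k * \<alpha> + 2))"
      using assms by (intro divide_left_mono mult_pos_pos[OF G_pos]) auto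
    then show ?thesis
      by (simp add: a_def q_def)
  qed
  have a_decreasing: "a (Suc k) \<le> a k" for k
    using a_Suc[of k] mult_right_mono[of q 1 "a k"] q a_nonneg[of k] by simp
  have a_le: "a k \<le> q ^ k" for k
  proof (induction k)
    case 0
    then show ?case by (simp add: a_def Gamma_2)
  next
    case (Suc k)
    then show ?case
      using a_Suc[of k] mult_left_mono[OF Suc q(1)] by simp
  qed
  have a_lim: "a \<longlonglongrightarrow> 0"
    by (rule tendsto_sandwich[OF _ _ tendsto_const LIMSEQ_power_zero[of q]])
      (use a_nonneg a_le q in auto)
  have "0 < a 0 - a 1"
    using q by (simp add: a_def q_def Gamma_2)
  also have "\<dots> = (\<Sum>k<2 * 1. (-1) ^ k * a k)"
    by (simp add: numeral_2_eq_2)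
  also have "\<dots> \<le> (\<Sum>k. (-1) ^ k * a k)"
    by (rule summable_Leibniz'(2)[OF a_lim a_nonneg a_decreasing])
  also have "\<dots> = mittag_leffler \<alpha> 2 (- z)"
    by (simp add: mittag_leffler_def a_def power_minus[of z])
  finally show ?thesis .
qed

text \<open>
  The derivative of the function below is \<open>- ln (1 - 1/y) - 1/(y + 1)\<close>, and \<open>- ln (1 - 1/y)\<close> is at
  least \<open>1/y\<close>.
\<close>

lemma ln_self_power_quotient_strict_mono:
  fixes a b :: real
  defines "g \<equiv> \<lambda>y::real. y * ln y - (y - 1) * ln (y - 1) - ln (y + 1)"
  assumes "1 < a" "a < b"
  shows "g a < g b"
proof (rule DERIV_pos_imp_increasing[OF \<open>a < b\<close>])
  fix y assume "a \<le> y" "y \<le> b"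
  then have y: "1 < y" using assms by simp
  have "(g has_real_derivative (ln y - ln (y - 1) - 1 / (y + 1))) (at y)"
    unfolding g_def using y by (auto intro!: derivative_eq_intros)
  moreover have "1 / (y + 1) < ln y - ln (y - 1)"
  proof -
    have "ln ((y - 1) / y) \<le> (y - 1) / y - 1"
      using y by (intro ln_le_minus_one) simp
    also have "\<dots> = - (1 / y)"
      using y by (simp add: field_simps)
    also have "\<dots> < - (1 / (y + 1))"
      using y by (simp add: frac_less2)
    finally show ?thesis
      using y by (simp add: ln_div)
  qed
  ultimately show "\<exists>D. (g has_real_derivative D) (at y) \<and> 0 < D"
    by (intro exI[of _ "ln y - ln (y - 1) - 1 / (y + 1)"]) simp
qed

lemma self_power_quotient_less:
  fixes a b :: real
  assumes "1 < a" "a < b" and b: "b powr b / (b - 1) powr (b - 1) = b + 1"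
  shows "a powr a / (a - 1) powr (a - 1) < a + 1"
proof -
  have ln_eq: "ln (y powr y / (y - 1) powr (y - 1)) = y * ln y - (y - 1) * ln (y - 1)"
    if "1 < y" for y :: real
    using that by (simp add: ln_div ln_powr)
  have "b * ln b - (b - 1) * ln (b - 1) = ln (b + 1)"
    using ln_eq[of b] b assms by simp
  then have "ln (a powr a / (a - 1) powr (a - 1)) < ln (a + 1)"
    using ln_eq[of a] ln_self_power_quotient_strict_mono[of a b] assms by simp
  then show ?thesis
    using assms by (subst (asm) ln_less_cancel_iff) simp_all
qed

theorem theorem3p7:
  fixes \<alpha>bar \<alpha> :: real
  assumes "\<alpha>bar \<in> {1<..<2}"
    and "\<alpha>bar powr \<alpha>bar / (\<alpha>bar - 1) powr (\<alpha>bar - 1) = \<alpha>bar + 1"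
    and "1 < \<alpha>" and "\<alpha> < \<alpha>bar"
  shows "(\<forall>x \<in> {- (Gamma \<alpha> * (1 + \<alpha>))<..<0}. mittag_leffler \<alpha> 2 x \<noteq> 0) \<and>
    {- (Gamma \<alpha> * (1 + \<alpha>))<..<0} \<supset>
      {- (Gamma \<alpha> * (\<alpha> powr \<alpha> / (\<alpha> - 1) powr (\<alpha> - 1)))..<0}"
proof (intro conjI ballI)
  have G_pos: "0 < Gamma \<alpha>"
    using assms by (intro Gamma_real_pos) simp
  have "\<alpha> \<notin> \<int>\<^sub>\<le>\<^sub>0" "\<alpha> + 1 \<notin> \<int>\<^sub>\<le>\<^sub>0"
    using assms by (auto elim!: nonpos_Ints_cases')
  then have "Gamma (\<alpha> + 1 + 1) = (\<alpha> + 1) * (\<alpha> * Gamma \<alpha>)"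
    by (simp only: Gamma_plus1 not_False_eq_True)
  then have G2: "Gamma (\<alpha> + 2) = \<alpha> * (Gamma \<alpha> * (1 + \<alpha>))"
    by (simp add: algebra_simps)
  have bound: "Gamma \<alpha> * (1 + \<alpha>) < Gamma (\<alpha> + 2)"
    unfolding G2 using assms G_pos by simp
  show "mittag_leffler \<alpha> 2 x \<noteq> 0" if "x \<in> {- (Gamma \<alpha> * (1 + \<alpha>))<..<0}" for x
    using mittag_leffler_2_pos[of \<alpha> "- x"] that bound assms by simp
  define c where "c = \<alpha> powr \<alpha> / (\<alpha> - 1) powr (\<alpha> - 1)"
  have "0 < c" "c < 1 + \<alpha>"
    using self_power_quotient_less[of \<alpha> \<alpha>bar] assms by (simp_all add: c_def)
  then have c: "0 < Gamma \<alpha> * c" "Gamma \<alpha> * c < Gamma \<alpha> * (1 + \<alpha>)"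
    using G_pos by simp_all
  \<comment> \<open>A point strictly between the two left endpoints makes the inclusion strict.\<close>
  obtain m where m: "- (Gamma \<alpha> * (1 + \<alpha>)) < m" "m < - (Gamma \<alpha> * c)"
    using dense[OF c(2)[THEN neg_less_iff_less[THEN iffD2]]] by blast
  have "m \<in> {- (Gamma \<alpha> * (1 + \<alpha>))<..<0}" "m \<notin> {- (Gamma \<alpha> * c)..<0}"
    using c(1) m unfolding greaterThanLessThan_iff atLeastLessThan_iff by linarith+
  moreover have "{- (Gamma \<alpha> * c)..<0} \<subseteq> {- (Gamma \<alpha> * (1 + \<alpha>))<..<0}"
    using c(2) by (intro subsetI)
      (unfold greaterThanLessThan_iff atLeastLessThan_iff, linarith)
  ultimately show "{- (Gamma \<alpha> * (\<alpha> powr \<alpha> / (\<alpha> - 1) powr (\<alpha> - 1)))..<0}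
      \<subset> {- (Gamma \<alpha> * (1 + \<alpha>))<..<0}"
    unfolding c_def by blast
qed

end
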